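(* Suppose $d\geq2$ and $[0,1]^d$ is the $d$-dimensional unit cube. Let $\mathrm d\mu=\mathbf 1_{[0,1]^d}\cdot\mathrm d\mathcal H_d$. If $X_N=\{x_1,\dots,x_N\}$ is a set of $N$ points, independently and randomly distributed over $[0,1]^d$ with respect to $\mu$, then for any $p\geq1$ $$\lim_{N\to\infty}\mathbb E[\rho(X_N,[0,1]^d)^p]\cdot\left[\frac{N}{\log N}\right]^{p/d}=\left(\frac{2^{d-1}}{d\,\upsilon_d}\right)^{p/d}.$$
   Context: $\mathcal H_d$ is $d$-dimensional Hausdorff measure on $\mathbb R^d$ normalized by $\mathcal H_d([0,1]^d)=1$ (i.e. Lebesgue measure); $\upsilon_d=\pi^{d/2}/\Gamma(1+d/2)$ is the volume of the unit ball in $\mathbb R^d$. The covering radius is $\rho(X_N,K):=\sup_{y\in K}\min_j|y-x_j|$ (Euclidean distance). *)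

theory Defs
  imports "HOL-Probability.Probability"
begin

text \<open>Here \<open>1\<close> is the vector \<open>(1,\<dots>,1)\<close>.\<close>
definition unit_cube :: "(real ^ 'n) set" where
  "unit_cube = cbox 0 1"

text \<open>\<open>d\<close>-dimensional Hausdorff measure on \<open>\<real>\<^sup>d\<close>, normalized to give the unit cube mass 1,
  is Lebesgue measure.\<close>
definition cube_measure :: "(real ^ 'n) measure" where
  "cube_measure = density lborel (indicator unit_cube)"

text \<open>Meaningful for finite nonempty \<open>X\<close> and bounded nonempty \<open>K\<close>, when the minimum is attained and
  the supremum is that of a nonempty set bounded above.\<close>
definition covering_radius :: "'a::metric_space set \<Rightarrow> 'a set \<Rightarrow> real" where
  "covering_radius X K = (SUP y\<in>K. MIN x\<in>X. dist y x)"

end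

theory Submission
  imports Defs "HOL-Real_Asymp.Real_Asymp"
begin

text \<open>
  Write \<open>d\<close> for the dimension, \<open>v\<close> for the volume of the unit ball and \<open>r\<^sup>d = a * ln N / N\<close>. The covering
  radius exceeds \<open>r\<close> when some ball of radius \<open>r\<close> about a point of the cube contains no sample point.
  Near a face of dimension \<open>k\<close> such a ball may retain only the fraction \<open>2 ^ k / 2 ^ d\<close> of its volume,
  so it is vacant with probability about \<open>N\<close> to the power \<open>- a * v * 2 ^ k / 2 ^ d\<close>; and about \<open>r\<close> to
  the power \<open>- k\<close>, that is \<open>N\<close> to the power \<open>k / d\<close> up to logarithms, such balls are needed to
  exhaust the neighbourhood of the face. The two exponents balance at
  \<open>a = k * 2 ^ d / (d * v * 2 ^ k)\<close>. Since \<open>2 * k \<le> 2 ^ k\<close>, this is largest for \<open>k = 1\<close> (and again for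
  \<open>k = 2\<close>), where it equals \<open>2 ^ (d - 1) / (d * v)\<close>: the covering radius is governed by the holes
  along the edges.

  For \<open>a\<close> below this constant, take disjoint balls centred on one edge. Their vacancy events are
  negatively correlated and their expected number tends to infinity, so by the second moment method
  one of them occurs with probability tending to 1 (\<open>prob_rho_less\<close>, \<open>tendsto_prob_rho_less\<close>).

  For \<open>a\<close> above the constant, apply the union bound to a grid whose mesh is a small fraction of \<open>r\<close>.
  The sum over all grid points, sorted by the face that they are close to, is controlled by giving
  each coordinate the weight 1 if it is near the boundary and \<open>1 / (L + 1)\<close> otherwise, for the sum of
  the products of these weights factors (\<open>prob_less_rho_strata\<close>). The result is a bound by a negative
  power of \<open>N\<close> that improves without limit as \<open>a\<close> grows (\<open>prob_less_rho_tail\<close>,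
  \<open>eventually_prob_less_rho\<close>).

  For the moments, the lower bound is Markov's inequality. For the upper bound a single level does
  not suffice, because just above the constant the tail decays too slowly to absorb the factor
  \<open>(N / ln N)\<close> to the power \<open>p / d\<close>. A second level with a large \<open>a\<close> has the same order of magnitude and
  a tail as small as needed (\<open>expectation_rho_powr_le\<close>).
\<close>

section \<open>Volumes of balls cut by the unit cube\<close>

text \<open>Reflections in hyperplanes orthogonal to a coordinate axis are of this form; they are the symmetries
  from which the volume of a ball sector is computed.\<close>
lemma measure_lborel_vimage_signed_translation:
  fixes t :: "real ^ 'n" and e :: "'n \<Rightarrow> real"
  assumes e: "\<And>i. \<bar>e i\<bar> = 1" and A: "A \<in> sets borel"
  shows "measure lborel ((\<lambda>x. \<chi> i. t $ i + e i * x $ i) -` A) = measure lborel A"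
proof -
  define T :: "real ^ 'n \<Rightarrow> real ^ 'n" where "T = (\<lambda>x. \<chi> i. t $ i + e i * x $ i)"
  define c :: "real ^ 'n \<Rightarrow> real" where "c b = e (axis_index b)" for b
  have T_eq: "t + (\<Sum>j\<in>Basis. (c j * (x \<bullet> j)) *\<^sub>R j) = T x" for x
  proof -
    have "(\<Sum>j\<in>Basis. (c j * (x \<bullet> j)) *\<^sub>R j) $ i = e i * x $ i" for i
    proof -
      have "(\<Sum>j\<in>Basis. (c j * (x \<bullet> j)) *\<^sub>R j) \<bullet> axis i 1 = c (axis i 1) * (x \<bullet> axis i 1)"
        by (simp add: axis_in_Basis_iff)
      then show ?thesis
        by (simp add: c_def inner_axis axis_index_axis)
    qed
    then show ?thesis
      by (simp add: T_def vec_eq_iff)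
  qed
  have c: "\<bar>c b\<bar> = 1" for b
    by (simp add: c_def e)
  have T_meas: "T \<in> borel \<rightarrow>\<^sub>M borel"
    unfolding T_eq[abs_def, symmetric] by simp
  have "c b \<noteq> 0" for b using c[of b] by auto
  then have "(lborel :: (real ^ 'n) measure) = density (distr lborel borel T) (\<lambda>_. 1)"
    using lborel_affine_euclidean[of c t] by (simp add: T_eq c)
  then have "measure lborel A = measure (distr lborel borel T) A"
    by (simp add: density_1)
  also have "\<dots> = measure lborel (T -` A)"
    using T_meas A by (subst measure_distr) auto
  finally show ?thesis
    by (simp add: T_def)
qed

text \<open>For \<open>\<sigma>\<close> with values \<open>1\<close> and \<open>-1\<close>, one of the pieces into which hyperplanes through the centre and
  orthogonal to the axes cut the ball. The signs are free so that the piece can be turned towards the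
  interior of the cube.\<close>
definition ball_sector :: "real ^ 'n \<Rightarrow> real \<Rightarrow> ('n \<Rightarrow> real) \<Rightarrow> 'n set \<Rightarrow> (real ^ 'n) set" where
  "ball_sector z s \<sigma> S = {x \<in> ball z s. \<forall>i\<in>S. 0 \<le> \<sigma> i * (x $ i - z $ i)}"

lemma ball_sector_borel: "ball_sector z s \<sigma> S \<in> sets borel"
proof -
  have "ball_sector z s \<sigma> S = ball z s \<inter> (\<Inter>i\<in>S. {x. 0 \<le> \<sigma> i * (x $ i - z $ i)})"
    by (auto simp: ball_sector_def)
  moreover have "closed (\<Inter>i\<in>S. {x. 0 \<le> \<sigma> i * (x $ i - z $ i)})"
    by (intro closed_INT ballI closed_Collect_le continuous_intros)
  ultimately show ?thesis
    by (simp add: borel_closed)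
qed

lemma fmeasurable_subset_ball:
  fixes z :: "'a::euclidean_space"
  assumes "A \<in> sets borel" "A \<subseteq> ball z s"
  shows "A \<in> fmeasurable lborel"
  using assms emeasure_bounded_finite[OF bounded_subset[OF bounded_ball assms(2)]]
  by (intro fmeasurableI) auto

lemma AE_lborel_component_neq:
  "AE x in lborel. (x :: real ^ 'n) $ k \<noteq> a"
proof -
  have "negligible {x :: real ^ 'n. x $ k = a}"
    using negligible_standard_hyperplane[of "axis k 1 :: real ^ 'n" a]
    by (simp add: axis_in_Basis_iff inner_axis)
  moreover have "closed {x :: real ^ 'n. x $ k = a}"
    by (intro closed_Collect_eq continuous_intros)
  ultimately have "{x :: real ^ 'n. x $ k = a} \<in> null_sets lborel"
    by (simp add: negligible_iff_null_sets null_sets_completion_iff borel_closed)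
  then show ?thesis
    by (rule AE_I') auto
qed

text \<open>Reflection about the hyperplane through the centre orthogonal to direction \<open>k\<close> exchanges the two
  halves into which that hyperplane cuts the sector, and the hyperplane is a null set. So each
  further cut halves the volume.\<close>
lemma measure_ball_sector:
  fixes z :: "real ^ 'n"
  assumes "0 \<le> s" and sign: "\<And>i. \<bar>\<sigma> i\<bar> = 1"
  shows "measure lborel (ball_sector z s \<sigma> S)
           = unit_ball_vol (real CARD('n)) * s ^ CARD('n) / 2 ^ card S"
proof (induction S rule: finite_induct[OF finite])
  case 1
  then show ?case
    using content_ball[OF \<open>0 \<le> s\<close>, of z] by (simp add: ball_sector_def ball_def)
next
  case (2 k S)
  define H where "H = ball_sector z s \<sigma> (insert k S)"
  define H' where "H' = ball_sector z s (\<sigma>(k := - \<sigma> k)) (insert k S)"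
  have borel: "H \<in> sets borel" "H' \<in> sets borel"
    by (simp_all add: H_def H'_def ball_sector_borel)
  have fm: "H \<in> fmeasurable lborel" "H' \<in> fmeasurable lborel"
    by (rule fmeasurable_subset_ball[where z = z and s = s]; use borel in \<open>auto simp: H_def H'_def ball_sector_def\<close>)+
  define T :: "real ^ 'n \<Rightarrow> real ^ 'n"
    where "T x = (\<chi> i. (\<chi> i. if i = k then 2 * z $ k else 0) $ i + (if i = k then -1 else 1) * x $ i)" for x
  have T_nth: "T x $ i = (if i = k then 2 * z $ k - x $ k else x $ i)" for x i
    by (simp add: T_def)
  have dist_T: "dist z (T x) = dist z x" for x
    unfolding dist_norm norm_vec_def L2_set_def
    by (intro arg_cong[where f = sqrt] sum.cong) (auto simp: T_nth power2_eq_square algebra_simps)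
  have "T -` H = H'"
    using \<open>k \<notin> S\<close> 
    by (auto simp: H_def H'_def ball_sector_def dist_T T_nth algebra_simps split: if_splits)
  then have "measure lborel H' = measure lborel H"
    using measure_lborel_vimage_signed_translation[of "\<lambda>i. if i = k then -1 else 1" H
        "\<chi> i. if i = k then 2 * z $ k else 0"] borel
    by (simp add: T_def[abs_def])
  moreover have "measure lborel (H \<union> H') = measure lborel H + measure lborel H'"
  proof (rule measure_Un_AE[OF _ fm])
    show "AE x in lborel. x \<notin> H \<or> x \<notin> H'"
      using AE_lborel_component_neq[of k "z $ k"]
    proof eventually_elim
      case (elim x)
      then show ?case using sign[of k]
        by (auto simp: H_def H'_def ball_sector_def mult_le_0_iff zero_le_mult_iff)
    qed
  qed
  moreover have "H \<union> H' = ball_sector z s \<sigma> S"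
    using \<open>k \<notin> S\<close> by (auto simp: H_def H'_def ball_sector_def)
  ultimately show ?case
    using 2 by (simp add: H_def)
qed

lemma mem_unit_cube: "x \<in> unit_cube \<longleftrightarrow> (\<forall>i. 0 \<le> x $ i \<and> x $ i \<le> 1)"
  by (auto simp: unit_cube_def mem_box_cart)

lemma unit_cube_borel [measurable]: "unit_cube \<in> sets borel"
  by (simp add: unit_cube_def)

lemma unit_cube_bounded: "bounded (unit_cube :: (real ^ 'n) set)"
  and unit_cube_nonempty: "unit_cube \<noteq> ({} :: (real ^ 'n) set)"
proof -
  have "(0 :: real ^ 'n) \<in> unit_cube" by (simp add: mem_unit_cube)
  then show "unit_cube \<noteq> ({} :: (real ^ 'n) set)" by auto
qed (simp add: unit_cube_def)

lemma measure_cube_measure: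
  assumes "A \<in> sets borel"
  shows "measure cube_measure A = measure lborel (A \<inter> unit_cube)"
proof -
  have "emeasure cube_measure A = emeasure lborel (unit_cube \<inter> A)"
    using assms by (simp add: cube_measure_def emeasure_density flip: indicator_inter_arith)
  then show ?thesis
    by (simp add: measure_def Int_commute)
qed

text \<open>In each direction in which \<open>z\<close> is closer than \<open>s\<close> to the boundary, keep the half of the ball
  facing the centre of the cube. The resulting sector lies in the cube because \<open>2 * s \<le> 1\<close>, so at
  most a factor 2 is lost per such direction.\<close>
lemma measure_ball_Int_unit_cube_ge:
  fixes z :: "real ^ 'n"
  assumes z: "z \<in> unit_cube" and s: "0 < s" "s \<le> 1/2"
  shows "unit_ball_vol (real CARD('n)) * s ^ CARD('n) / 2 ^ card {i. z $ i < s \<or> z $ i > 1 - s}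
           \<le> measure lborel (ball z s \<inter> unit_cube)"
proof -
  define \<sigma> where "\<sigma> i = (if z $ i < s then 1 else -1 :: real)" for i
  let ?B = "ball_sector z s \<sigma> {i. z $ i < s \<or> z $ i > 1 - s}"
  have "?B \<subseteq> ball z s \<inter> unit_cube"
  proof
    fix x assume x: "x \<in> ?B"
    have "0 \<le> x $ i \<and> x $ i \<le> 1" for i
    proof -
      have "\<bar>(x - z) $ i\<bar> < s"
        using component_le_norm_cart[of "x - z" i] x
        by (simp add: ball_sector_def dist_norm norm_minus_commute)
      then have "\<bar>x $ i - z $ i\<bar> < s" by simp
      moreover have "0 \<le> z $ i" "z $ i \<le> 1"
        using z by (auto simp: mem_unit_cube)
      moreover have "z $ i < s \<longrightarrow> z $ i \<le> x $ i" "\<not> z $ i < s \<longrightarrow> z $ i > 1 - s \<longrightarrow> x $ i \<le> z $ i"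
        using x by (auto simp: ball_sector_def \<sigma>_def)
      ultimately show ?thesis using s by linarith
    qed
    then show "x \<in> ball z s \<inter> unit_cube"
      using x by (simp add: ball_sector_def mem_unit_cube)
  qed
  then have "measure lborel ?B \<le> measure lborel (ball z s \<inter> unit_cube)"
    by (intro measure_mono_fmeasurable fmeasurable_subset_ball[of _ z s]) (auto simp: ball_sector_borel)
  then show ?thesis
    using s by (subst (asm) measure_ball_sector) (auto simp: \<sigma>_def)
qed

text \<open>The matching estimate for balls centred on a face: in the directions in \<open>S\<close> the cube
  is on one side of the centre only.\<close>
lemma measure_ball_Int_unit_cube_le:
  fixes z :: "real ^ 'n"
  assumes z: "\<And>i. i \<in> S \<Longrightarrow> z $ i = 0" and s: "0 \<le> s"
  shows "measure lborel (ball z s \<inter> unit_cube)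
           \<le> unit_ball_vol (real CARD('n)) * s ^ CARD('n) / 2 ^ card S"
proof -
  have "ball z s \<inter> unit_cube \<subseteq> ball_sector z s (\<lambda>_. 1) S"
    using z by (auto simp: ball_sector_def mem_unit_cube)
  moreover have "ball_sector z s (\<lambda>_. 1) S \<in> fmeasurable lborel"
    by (rule fmeasurable_subset_ball[of _ z s, OF ball_sector_borel]) (auto simp: ball_sector_def)
  ultimately have "measure lborel (ball z s \<inter> unit_cube) \<le> measure lborel (ball_sector z s (\<lambda>_. 1) S)"
    by (intro measure_mono_fmeasurable) auto
  also have "\<dots> = unit_ball_vol (real CARD('n)) * s ^ CARD('n) / 2 ^ card S"
    using s by (intro measure_ball_sector) auto
  finally show ?thesis .
qed

section \<open>Covering radius\<close>

lemma less_covering_radius_iff: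
  assumes X: "finite X" "X \<noteq> {}" and K: "bounded K" "K \<noteq> {}"
  shows "r < covering_radius X K \<longleftrightarrow> (\<exists>y\<in>K. \<forall>x\<in>X. r < dist y x)"
proof -
  obtain a where "a \<in> X" using X by auto
  obtain e where e: "\<And>y. y \<in> K \<Longrightarrow> dist a y \<le> e"
    using K bounded_any_center[of K a] by auto
  have "bdd_above ((\<lambda>y. MIN x\<in>X. dist y x) ` K)"
  proof (rule bdd_aboveI2)
    fix y assume "y \<in> K"
    have "(MIN x\<in>X. dist y x) \<le> dist y a"
      using X \<open>a \<in> X\<close> by (intro Min_le) auto
    then show "(MIN x\<in>X. dist y x) \<le> e"
      using e[OF \<open>y \<in> K\<close>] by (simp add: dist_commute)
  qed
  then show ?thesis
    using X K by (simp add: covering_radius_def less_cSUP_iff)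
qed

lemma covering_radius_nonneg:
  assumes "finite X" "X \<noteq> {}" "bounded K" "K \<noteq> {}"
  shows "0 \<le> covering_radius X K"
proof (rule ccontr)
  obtain y where "y \<in> K" using assms by auto
  assume "\<not> 0 \<le> covering_radius X K"
  then obtain r where "covering_radius X K < r" "r < 0"
    using dense[of "covering_radius X K" 0] by auto
  moreover have "r < covering_radius X K"
    unfolding less_covering_radius_iff[OF assms]
    using \<open>y \<in> K\<close> \<open>r < 0\<close> by (intro bexI[of _ y] ballI less_le_trans[OF \<open>r < 0\<close>]) auto
  ultimately show False by simp
qed

text \<open>The supremum may range over an uncountable set. Whether it exceeds \<open>r\<close> is however decided
  on a countable dense subset \<open>T\<close> of \<open>K\<close>, because the points at distance more than \<open>r\<close> from the sample
  form an open set.\<close>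
lemma borel_measurable_covering_radius:
  fixes X :: "'i \<Rightarrow> 'w \<Rightarrow> 'a::euclidean_space"
  assumes I: "finite I" "I \<noteq> {}" and K: "bounded K" "K \<noteq> {}"
    and X [measurable]: "\<And>j. j \<in> I \<Longrightarrow> X j \<in> borel_measurable M"
  shows "(\<lambda>\<omega>. covering_radius ((\<lambda>j. X j \<omega>) ` I) K) \<in> borel_measurable M"
proof (rule borel_measurable_iff_greater[THEN iffD2, rule_format])
  fix r :: real
  obtain T where T: "countable T" "T \<subseteq> K" "K \<subseteq> closure T"
    using separable by blast
  have *: "(\<exists>y\<in>K. \<forall>j\<in>I. r < dist y (X j \<omega>)) \<longleftrightarrow> (\<exists>y\<in>T. \<forall>j\<in>I. r < dist y (X j \<omega>))" for \<omega>
  proof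
    define U where "U = (\<Inter>j\<in>I. {y. r < dist y (X j \<omega>)})"
    assume "\<exists>y\<in>K. \<forall>j\<in>I. r < dist y (X j \<omega>)"
    then obtain y where y: "y \<in> closure T" "y \<in> U"
      using T by (auto simp: U_def)
    have "open U"
      unfolding U_def using I by (intro open_INT ballI open_Collect_less continuous_intros)
    then have "U \<inter> T \<noteq> {}"
      using y open_Int_closure_eq_empty by blast
    then show "\<exists>y\<in>T. \<forall>j\<in>I. r < dist y (X j \<omega>)"
      by (auto simp: U_def)
  qed (use T in blast)
  have "r < covering_radius ((\<lambda>j. X j \<omega>) ` I) K \<longleftrightarrow> (\<exists>y\<in>T. \<forall>j\<in>I. r < dist y (X j \<omega>))" for \<omega>
    using I K by (simp add: less_covering_radius_iff *)
  then have "{\<omega> \<in> space M. r < covering_radius ((\<lambda>j. X j \<omega>) ` I) K}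
      = (\<Union>y\<in>T. {\<omega> \<in> space M. \<forall>j\<in>I. r < dist y (X j \<omega>)})"
    by auto
  also have "\<dots> \<in> sets M"
  proof (rule sets.countable_UN''[OF T(1)])
    fix y
    show "{\<omega> \<in> space M. \<forall>j\<in>I. r < dist y (X j \<omega>)} \<in> sets M"
      using I by measurable
  qed
  finally show "{\<omega> \<in> space M. r < covering_radius ((\<lambda>j. X j \<omega>) ` I) K} \<in> sets M" .
qed

section \<open>A second moment inequality\<close>

text \<open>If \<open>Z\<close> is the centred number of events that occur and \<open>Q\<close> their expected number, then \<open>Z = - Q\<close>
  when none occurs, while negative correlation leaves only the diagonal terms in the variance, so
  that it is at most \<open>Q\<close>. Chebyshev's inequality bounds the probability that none occurs by
  \<open>Q / Q\<^sup>2\<close>.\<close>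
lemma (in prob_space) second_moment_bound:
  assumes I: "finite I" and E [measurable]: "\<And>i. i \<in> I \<Longrightarrow> E i \<in> events"
    and corr: "\<And>i j. i \<in> I \<Longrightarrow> j \<in> I \<Longrightarrow> i \<noteq> j \<Longrightarrow> prob (E i \<inter> E j) \<le> prob (E i) * prob (E j)"
    and q: "0 < q" "q \<le> (\<Sum>i\<in>I. prob (E i))"
  shows "prob {\<omega> \<in> space M. \<forall>i\<in>I. \<omega> \<notin> E i} \<le> 1 / q"
proof -
  define Q where "Q = (\<Sum>i\<in>I. prob (E i))"
  define Z where "Z \<omega> = (\<Sum>i\<in>I. indicator (E i) \<omega> - prob (E i))" for \<omega>
  define V where "V = {\<omega> \<in> space M. \<forall>i\<in>I. \<omega> \<notin> E i}"
  have [measurable]: "V \<in> events"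
    unfolding V_def using I by measurable
  have int: "integrable M (\<lambda>\<omega>. (indicator (E i) \<omega> - prob (E i)) * (indicator (E j) \<omega> - prob (E j)))"
    and expec: "expectation (\<lambda>\<omega>. (indicator (E i) \<omega> - prob (E i)) * (indicator (E j) \<omega> - prob (E j)))
                 = prob (E i \<inter> E j) - prob (E i) * prob (E j)"
    if [simp]: "i \<in> I" "j \<in> I" for i j
  proof -
    have [measurable]: "E i \<in> events" "E j \<in> events" using that by auto
    have eq: "(indicator (E i) \<omega> - prob (E i)) * (indicator (E j) \<omega> - prob (E j))
      = indicator (E i \<inter> E j) \<omega> - prob (E j) * indicator (E i) \<omega>
         - prob (E i) * indicator (E j) \<omega> + prob (E i) * prob (E j)" for \<omega>
      by (simp add: indicator_inter_arith algebra_simps)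
    show "integrable M (\<lambda>\<omega>. (indicator (E i) \<omega> - prob (E i)) * (indicator (E j) \<omega> - prob (E j)))"
      unfolding eq by (intro Bochner_Integration.integrable_add Bochner_Integration.integrable_diff
          integrable_mult_right integrable_real_indicator) (auto simp: emeasure_eq_measure)
    show "expectation (\<lambda>\<omega>. (indicator (E i) \<omega> - prob (E i)) * (indicator (E j) \<omega> - prob (E j)))
                 = prob (E i \<inter> E j) - prob (E i) * prob (E j)"
      unfolding eq by (simp add: prob_space emeasure_eq_measure)
  qed
  have sq: "Z \<omega> ^ 2 = (\<Sum>i\<in>I. \<Sum>j\<in>I. (indicator (E i) \<omega> - prob (E i)) * (indicator (E j) \<omega> - prob (E j)))" for \<omega>
    by (simp add: Z_def power2_eq_square sum_product)
  have "Q ^ 2 * prob V = expectation (\<lambda>\<omega>. Q ^ 2 * indicator V \<omega>)"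
    by simp
  also have "\<dots> \<le> expectation (\<lambda>\<omega>. Z \<omega> ^ 2)"
  proof (rule integral_mono)
    show "integrable M (\<lambda>\<omega>. Q ^ 2 * indicator V \<omega>)"
      by (intro integrable_mult_right integrable_real_indicator) (auto simp: emeasure_eq_measure)
    show "integrable M (\<lambda>\<omega>. Z \<omega> ^ 2)"
      unfolding sq by (intro Bochner_Integration.integrable_sum int)
    show "Q ^ 2 * indicator V \<omega> \<le> Z \<omega> ^ 2" for \<omega>
    proof (cases "\<omega> \<in> V")
      case True
      then have "Z \<omega> = - Q"
        by (simp add: Z_def Q_def V_def sum_negf)
      then show ?thesis using True by simp
    qed simp
  qed
  also have "\<dots> = (\<Sum>i\<in>I. \<Sum>j\<in>I. prob (E i \<inter> E j) - prob (E i) * prob (E j))"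
    unfolding sq by (simp add: Bochner_Integration.integral_sum Bochner_Integration.integrable_sum int expec)
  \<comment> \<open>off the diagonal the covariance is nonpositive; on it, it is at most the probability itself\<close>
  also have "\<dots> \<le> (\<Sum>i\<in>I. \<Sum>j\<in>I. if i = j then prob (E i) else 0)"
    using corr by (intro sum_mono) auto
  also have "\<dots> = Q"
    using I by (simp add: Q_def)
  finally have "Q ^ 2 * prob V \<le> Q" .
  moreover have "q \<le> Q" using q by (simp add: Q_def)
  ultimately have "Q * prob V \<le> 1"
    using \<open>0 < q\<close> by (simp add: power2_eq_square)
  then have "prob V \<le> 1 / Q"
    using \<open>0 < q\<close> \<open>q \<le> Q\<close> by (simp add: field_simps)
  also have "\<dots> \<le> 1 / q"
    using \<open>0 < q\<close> \<open>q \<le> Q\<close> by (intro divide_left_mono) auto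
  finally show ?thesis by (simp add: V_def)
qed

section \<open>Uniform samples in the cube\<close>

locale uniform_sample = prob_space M
  for M :: "'w measure" +
  fixes X :: "nat \<Rightarrow> 'w \<Rightarrow> real ^ 'n" and N :: nat
  assumes N: "1 \<le> N"
    and indep: "indep_vars (\<lambda>_. borel) X {1..N}"
    and distr_X: "\<And>j. j \<in> {1..N} \<Longrightarrow> distr M borel (X j) = cube_measure"
begin

definition rho :: "'w \<Rightarrow> real" where
  "rho \<omega> = covering_radius ((\<lambda>j. X j \<omega>) ` {1..N}) unit_cube"

lemma X_measurable: "j \<in> {1..N} \<Longrightarrow> X j \<in> borel_measurable M"
  using indep by (simp add: indep_vars_def)

lemma sample_finite_nonempty: "finite ((\<lambda>j. X j \<omega>) ` {1..N})" "(\<lambda>j. X j \<omega>) ` {1..N} \<noteq> {}"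
  using N by auto

lemma rho_measurable [measurable]: "rho \<in> borel_measurable M"
  unfolding rho_def[abs_def] using N
  by (intro borel_measurable_covering_radius unit_cube_bounded unit_cube_nonempty X_measurable) simp_all

lemma less_rho_iff: "r < rho \<omega> \<longleftrightarrow> (\<exists>y\<in>unit_cube. \<forall>j\<in>{1..N}. r < dist y (X j \<omega>))"
  unfolding rho_def less_covering_radius_iff[OF sample_finite_nonempty unit_cube_bounded unit_cube_nonempty]
  by simp

lemma rho_nonneg: "0 \<le> rho \<omega>"
  unfolding rho_def
  by (rule covering_radius_nonneg[OF sample_finite_nonempty unit_cube_bounded unit_cube_nonempty])

lemma prob_X:
  assumes "j \<in> {1..N}" "A \<in> sets borel"
  shows "prob (X j -` A \<inter> space M) = measure lborel (A \<inter> unit_cube)"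
proof -
  have "prob (X j -` A \<inter> space M) = measure (distr M borel (X j)) A"
    using X_measurable assms by (simp add: measure_distr)
  then show ?thesis
    using assms by (simp add: distr_X measure_cube_measure)
qed

definition vacant :: "(real ^ 'n) set \<Rightarrow> 'w set" where
  "vacant A = {\<omega> \<in> space M. \<forall>j\<in>{1..N}. X j \<omega> \<notin> A}"

lemma vacant_event:
  assumes "A \<in> sets borel"
  shows "vacant A \<in> events"
proof -
  have "X j -` A \<inter> space M \<in> events" if "j \<in> {1..N}" for j
    using measurable_sets[OF X_measurable[OF that] assms] .
  then have "space M - (\<Union>j\<in>{1..N}. X j -` A \<inter> space M) \<in> events"
    by blast
  also have "space M - (\<Union>j\<in>{1..N}. X j -` A \<inter> space M) = vacant A"
    by (auto simp: vacant_def)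
  finally show ?thesis .
qed

lemma prob_vacant:
  assumes A: "A \<in> sets borel"
  shows "prob (vacant A) = (1 - measure lborel (A \<inter> unit_cube)) ^ N"
proof -
  have "vacant A = (\<Inter>j\<in>{1..N}. X j -` (- A) \<inter> space M)"
    using N by (auto simp: vacant_def)
  then have "prob (vacant A) = (\<Prod>j\<in>{1..N}. prob (X j -` (- A) \<inter> space M))"
    using N A indep_varsD[OF indep, of "{1..N}" "\<lambda>_. - A"] by simp
  also have "\<dots> = (\<Prod>j\<in>{1..N}. 1 - measure lborel (A \<inter> unit_cube))"
  proof (rule prod.cong)
    fix j assume j: "j \<in> {1..N}"
    have "X j -` (- A) \<inter> space M = space M - (X j -` A \<inter> space M)" by auto
    then show "prob (X j -` (- A) \<inter> space M) = 1 - measure lborel (A \<inter> unit_cube)"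
      using A j prob_X[OF j A] measurable_sets[OF X_measurable[OF j]] by (simp add: prob_compl)
  qed simp
  finally show ?thesis by simp
qed

lemma measure_Int_cube_le_1:
  assumes "A \<in> sets borel"
  shows "measure lborel (A \<inter> (unit_cube :: (real ^ 'n) set)) \<le> 1"
  using prob_X[of 1 A] N assms by (metis atLeastAtMost_iff le_refl prob_le_1)

text \<open>The sample points lie in the cube only almost surely, and off that event nothing bounds the
  covering radius. The crude bound by the dimension comes from comparing the Euclidean norm with the
  sum of the coordinates.\<close>
lemma AE_rho_le: "AE \<omega> in M. rho \<omega> \<le> real CARD('n)"
proof -
  have "prob (X 1 -` unit_cube \<inter> space M) = 1"
    using N prob_X[of 1 unit_cube] unit_cube_nonempty[where 'n = 'n]
    by (simp add: unit_cube_def content_cbox_cart)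
  then have "AE \<omega> in M. \<omega> \<in> X 1 -` unit_cube \<inter> space M"
    using N X_measurable[of 1] by (intro AE_prob_1) auto
  then show ?thesis
  proof eventually_elim
    case (elim \<omega>)
    have "dist y (X 1 \<omega>) \<le> real CARD('n)" if y: "y \<in> unit_cube" for y
    proof -
      have "dist y (X 1 \<omega>) \<le> (\<Sum>i\<in>UNIV. \<bar>(y - X 1 \<omega>) $ i\<bar>)"
        unfolding dist_norm by (rule norm_le_l1_cart)
      also have "\<dots> \<le> (\<Sum>i\<in>(UNIV :: 'n set). 1)"
      proof (rule sum_mono)
        fix i
        have "0 \<le> y $ i" "y $ i \<le> 1" "0 \<le> X 1 \<omega> $ i" "X 1 \<omega> $ i \<le> 1"
          using elim y by (auto simp: mem_unit_cube)
        then show "\<bar>(y - X 1 \<omega>) $ i\<bar> \<le> 1" by simp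
      qed
      finally show ?thesis by simp
    qed
    then have "\<not> real CARD('n) < rho \<omega>"
      unfolding less_rho_iff using N by (metis atLeastAtMost_iff le_refl not_le)
    then show ?case by simp
  qed
qed

end

section \<open>Vacant balls along an edge\<close>

context uniform_sample
begin

text \<open>Put \<open>m\<close> centres on an edge at distance \<open>2 * r\<close> from each other. If the ball of radius \<open>r\<close> about
  one of them contains no sample point, the covering radius is at least \<open>r\<close>. The balls are disjoint,
  hence their vacancy events are negatively correlated, because \<open>1 - (u + u') \<le> (1 - u) * (1 - u')\<close>.\<close>
lemma prob_rho_less:
  fixes r v :: real and m :: nat
  assumes r: "0 < r" and m: "0 < m" "2 * r * real m \<le> 1"
    and v: "unit_ball_vol (real CARD('n)) * r ^ CARD('n) / 2 ^ (CARD('n) - 1) \<le> v" "v < 1"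
  shows "prob {\<omega> \<in> space M. rho \<omega> < r} \<le> 1 / (real m * (1 - v) ^ N)"
proof -
  \<comment> \<open>the direction of the edge\<close>
  fix k :: 'n
  define y :: "nat \<Rightarrow> real ^ 'n" where "y i = axis k (2 * r * real i)" for i
  define u where "u i = measure lborel (ball (y i) r \<inter> unit_cube)" for i
  define E where "E i = vacant (ball (y i) r)" for i
  have y_cube: "y i \<in> unit_cube" if "i < m" for i
  proof -
    have "2 * r * real i \<le> 2 * r * real m"
      using that r by simp
    then have "2 * r * real i \<le> 1"
      using m by linarith
    then show ?thesis
      using r by (auto simp: mem_unit_cube y_def axis_def)
  qed
  have u_le: "u i \<le> v" for i
  proof -
    have "u i \<le> unit_ball_vol (real CARD('n)) * r ^ CARD('n) / 2 ^ card (UNIV - {k})"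
      unfolding u_def using r by (intro measure_ball_Int_unit_cube_le) (auto simp: y_def axis_def)
    also have "\<dots> \<le> v"
      using v by (simp add: card_Diff_singleton)
    finally show ?thesis .
  qed
  have prob_E: "prob (E i) = (1 - u i) ^ N" for i
    by (simp add: E_def u_def prob_vacant)
  have "prob {\<omega> \<in> space M. rho \<omega> < r} \<le> prob {\<omega> \<in> space M. \<forall>i\<in>{..<m}. \<omega> \<notin> E i}"
  proof (rule finite_measure_mono)
    have "r \<le> rho \<omega>" if "i < m" "\<omega> \<in> E i" for i \<omega>
    proof (rule dense_le)
      fix r' assume "r' < r"
      have "r' < dist (y i) (X j \<omega>)" if "j \<in> {1..N}" for j
        using \<open>\<omega> \<in> E i\<close> that \<open>r' < r\<close> by (force simp: E_def vacant_def)
      then show "r' \<le> rho \<omega>"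
        using y_cube[OF \<open>i < m\<close>] less_rho_iff less_imp_le by blast
    qed
    then show "{\<omega> \<in> space M. rho \<omega> < r} \<subseteq> {\<omega> \<in> space M. \<forall>i\<in>{..<m}. \<omega> \<notin> E i}"
      by (auto simp: not_le[symmetric])
    have "E i \<in> events" for i
      by (simp add: E_def vacant_event)
    then show "{\<omega> \<in> space M. \<forall>i\<in>{..<m}. \<omega> \<notin> E i} \<in> events"
      by measurable
  qed
  also have "\<dots> \<le> 1 / (real m * (1 - v) ^ N)"
  proof (rule second_moment_bound)
    show "E i \<in> events" for i
      by (simp add: E_def vacant_event)
    show "prob (E i \<inter> E j) \<le> prob (E i) * prob (E j)" if "i \<noteq> j" for i j
    proof -
      have disj: "ball (y i) r \<inter> ball (y j) r = {}"
      proof (rule disjoint_ballI)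
        have "y i - y j = (2 * r * (real i - real j)) *\<^sub>R axis k 1"
          by (simp add: y_def axis_def vec_eq_iff algebra_simps)
        then have "dist (y i) (y j) = 2 * r * \<bar>real i - real j\<bar>"
          using r by (simp add: dist_norm abs_mult)
        also have "\<dots> \<ge> 2 * r * 1"
          using \<open>i \<noteq> j\<close> r by (intro mult_left_mono) linarith+
        finally show "r + r \<le> dist (y i) (y j)" by simp
      qed
      have fm: "ball (y l) r \<inter> unit_cube \<in> fmeasurable lborel" for l
        by (rule fmeasurable_subset_ball[of _ "y l" r]) auto
      have "measure lborel ((ball (y i) r \<union> ball (y j) r) \<inter> unit_cube) = u i + u j"
        unfolding u_def Int_Un_distrib2 using disj fm
        by (subst measure_Un2) (auto intro!: arg_cong[where f = "measure lborel"])
      moreover have "E i \<inter> E j = vacant (ball (y i) r \<union> ball (y j) r)"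
        by (auto simp: E_def vacant_def)
      ultimately have "prob (E i \<inter> E j) = (1 - (u i + u j)) ^ N" "u i + u j \<le> 1"
        using measure_Int_cube_le_1[of "ball (y i) r \<union> ball (y j) r"] by (simp_all add: prob_vacant)
      moreover have "(1 - (u i + u j)) ^ N \<le> ((1 - u i) * (1 - u j)) ^ N"
        using \<open>u i + u j \<le> 1\<close> by (intro power_mono) (auto simp: algebra_simps u_def)
      ultimately show ?thesis
        by (simp add: prob_E power_mult_distrib)
    qed
    show "0 < real m * (1 - v) ^ N"
      using v m by simp
    have "real m * (1 - v) ^ N = (\<Sum>i<m. (1 - v) ^ N)"
      by simp
    also have "\<dots> \<le> (\<Sum>i<m. prob (E i))"
      unfolding prob_E using u_le v by (intro sum_mono power_mono) auto
    finally show "real m * (1 - v) ^ N \<le> (\<Sum>i<m. prob (E i))" .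
  qed simp
  finally show ?thesis .
qed

end

section \<open>Union bound over a grid\<close>

text \<open>Here \<open>k\<close> stands for the dimension of a face of the cube. Equality holds exactly for \<open>k = 1\<close> and
  \<open>k = 2\<close>: edges and two-dimensional faces have the same critical radius.\<close>
lemma two_mult_le_two_power: "2 * k \<le> (2 :: nat) ^ k"
proof (induction k)
  case (Suc k)
  then show ?case by (cases k) auto
qed simp

lemma ex_grid_point_near:
  fixes y :: "real ^ 'n"
  assumes L: "0 < L" and y: "y \<in> unit_cube"
  shows "\<exists>g\<in>UNIV \<rightarrow>\<^sub>E {..L}. dist y (\<chi> i. real (g i) / real L) \<le> real CARD('n) / real L"
proof
  define g where "g i = nat \<lfloor>y $ i * real L\<rfloor>" for i
  have y01: "0 \<le> y $ i" "y $ i \<le> 1" for i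
    using y by (auto simp: mem_unit_cube)
  have g_le: "real (g i) \<le> y $ i * real L" for i
    using y01 by (simp add: g_def)
  have le_g: "y $ i * real L \<le> real (g i) + 1" for i
    using y01[of i] unfolding g_def by linarith
  have "real (g i) \<le> real L" for i
    using g_le[of i] y01[of i] mult_right_mono[of "y $ i" 1 "real L"] by simp
  then show "g \<in> UNIV \<rightarrow>\<^sub>E {..L}"
    by auto
  have "dist y (\<chi> i. real (g i) / real L) \<le> (\<Sum>i\<in>UNIV. \<bar>(y - (\<chi> i. real (g i) / real L)) $ i\<bar>)"
    unfolding dist_norm by (rule norm_le_l1_cart)
  also have "\<dots> \<le> (\<Sum>i\<in>(UNIV :: 'n set). 1 / real L)"
  proof (rule sum_mono)
    fix i
    have "y $ i - real (g i) / real L = (y $ i * real L - real (g i)) / real L"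
      using L by (simp add: field_simps)
    then show "\<bar>(y - (\<chi> i. real (g i) / real L)) $ i\<bar> \<le> 1 / real L"
      using L g_le[of i] le_g[of i] by (simp add: divide_le_cancel)
  qed
  finally show "dist y (\<chi> i. real (g i) / real L) \<le> real CARD('n) / real L"
    by simp
qed

lemma card_nat_less_real:
  assumes "0 \<le> c"
  shows "real (card {i :: nat. real i < c}) \<le> c + 1"
proof -
  have "card {i :: nat. real i < c} \<le> card {..<nat \<lceil>c\<rceil>}"
    by (intro card_mono) (auto, linarith)
  then show ?thesis
    using assms by simp linarith
qed

definition near_boundary :: "real \<Rightarrow> nat \<Rightarrow> nat \<Rightarrow> bool" where
  "near_boundary s L i \<longleftrightarrow> real i / real L < s \<or> real i / real L > 1 - s"

text \<open>All but about \<open>2 * s * L\<close> of the \<open>L + 1\<close> grid coordinates have weight \<open>1 / (L + 1)\<close>, so the total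
  weight stays bounded when \<open>L\<close> is of the order of \<open>1 / s\<close>. Taking products over the coordinates
  then counts grid points by the face they are close to.\<close>
lemma sum_near_boundary_weight:
  assumes L: "0 < L" and s: "0 < s"
  shows "(\<Sum>i\<le>L. if near_boundary s L i then 1 else 1 / (real L + 1)) \<le> 3 + 2 * s * real L"
proof -
  let ?A = "{i. real i < s * real L}"
  have fin: "finite ?A"
    by (rule finite_subset[of _ "{..nat \<lceil>s * real L\<rceil>}"]) (auto, linarith)
  have cardA: "real (card ?A) \<le> s * real L + 1"
    using s by (intro card_nat_less_real) simp
  have sub: "{i. i \<le> L \<and> near_boundary s L i} \<subseteq> ?A \<union> (\<lambda>i. L - i) ` ?A"
  proof
    fix i assume "i \<in> {i. i \<le> L \<and> near_boundary s L i}"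
    then have "i \<le> L" "real i < s * real L \<or> real (L - i) < s * real L"
      using L by (auto simp: near_boundary_def field_simps)
    moreover have "i = L - (L - i)" using \<open>i \<le> L\<close> by simp
    ultimately show "i \<in> ?A \<union> (\<lambda>i. L - i) ` ?A" by blast
  qed
  have "card {i. i \<le> L \<and> near_boundary s L i} \<le> card (?A \<union> (\<lambda>i. L - i) ` ?A)"
    using fin by (intro card_mono sub) simp
  also have "\<dots> \<le> card ?A + card ?A"
    using card_Un_le[of ?A "(\<lambda>i. L - i) ` ?A"] card_image_le[OF fin, of "\<lambda>i. L - i"] by linarith
  finally have card: "real (card {i. i \<le> L \<and> near_boundary s L i}) \<le> 2 * (s * real L + 1)"
    using cardA of_nat_mono[of "card {i. i \<le> L \<and> near_boundary s L i}" "card ?A + card ?A", where 'a = real]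
    by simp
  have "(\<Sum>i\<le>L. if near_boundary s L i then 1 else 1 / (real L + 1))
      \<le> (\<Sum>i\<le>L. (if near_boundary s L i then 1 else 0) + 1 / (real L + 1))"
    by (intro sum_mono) auto
  also have "\<dots> = real (card {i. i \<le> L \<and> near_boundary s L i}) + (\<Sum>i\<le>L. 1 / (real L + 1))"
    by (simp add: sum.distrib sum.If_cases Int_def)
  also have "(\<Sum>i\<le>L. 1 / (real L + 1)) = 1"
    by (simp add: add.commute)
  finally show ?thesis
    using card by simp
qed

context uniform_sample
begin

text \<open>If \<open>y\<close> is farther than \<open>r\<close> from the sample, then a grid point near \<open>y\<close> is farther than \<open>s\<close> from
  it: the mesh of the grid is paid for by the gap between \<open>s\<close> and \<open>r\<close>. The union bound over the grid
  is then combined with the volume estimate for balls meeting the cube.\<close>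
lemma prob_less_rho_grid:
  assumes s: "0 < s" "s \<le> 1/2" and L: "0 < L" and r: "s + real CARD('n) / real L \<le> r"
  shows "prob {\<omega> \<in> space M. r < rho \<omega>}
    \<le> (\<Sum>g\<in>(UNIV :: 'n set) \<rightarrow>\<^sub>E {..L}. exp (- (real N * (unit_ball_vol (real CARD('n)) * s ^ CARD('n))
                    / 2 ^ card {i. near_boundary s L (g i)})))"
proof -
  define V where "V = unit_ball_vol (real CARD('n)) * s ^ CARD('n)"
  define z :: "('n \<Rightarrow> nat) \<Rightarrow> real ^ 'n" where "z g = (\<chi> i. real (g i) / real L)" for g
  let ?G = "(UNIV :: 'n set) \<rightarrow>\<^sub>E {..L}"
  have "finite ?G" by (intro finite_PiE) auto
  have z_cube: "z g \<in> unit_cube" if "g \<in> ?G" for g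
    using that L by (auto simp: mem_unit_cube z_def)
  have "{\<omega> \<in> space M. r < rho \<omega>} \<subseteq> (\<Union>g\<in>?G. vacant (ball (z g) s))"
  proof
    fix \<omega> assume \<omega>: "\<omega> \<in> {\<omega> \<in> space M. r < rho \<omega>}"
    then obtain y where y: "y \<in> unit_cube" "\<forall>j\<in>{1..N}. r < dist y (X j \<omega>)"
      by (auto simp: less_rho_iff)
    obtain g where g: "g \<in> ?G" "dist y (z g) \<le> real CARD('n) / real L"
      using ex_grid_point_near[OF L y(1)] unfolding z_def by blast
    have "s \<le> dist (z g) (X j \<omega>)" if "j \<in> {1..N}" for j
    proof -
      have "r < dist y (X j \<omega>)" using y that by blast
      then show ?thesis
        using g r dist_triangle[of y "X j \<omega>" "z g"] by linarith
    qed
    then show "\<omega> \<in> (\<Union>g\<in>?G. vacant (ball (z g) s))"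
      using \<omega> by (intro UN_I[OF g(1)]) (auto simp: vacant_def not_less)
  qed
  then have "prob {\<omega> \<in> space M. r < rho \<omega>} \<le> prob (\<Union>g\<in>?G. vacant (ball (z g) s))"
    using \<open>finite ?G\<close> by (intro finite_measure_mono sets.finite_UN) (auto simp: vacant_event)
  also have "\<dots> \<le> (\<Sum>g\<in>?G. prob (vacant (ball (z g) s)))"
    using \<open>finite ?G\<close> by (intro finite_measure_subadditive_finite) (auto simp: vacant_event)
  also have "\<dots> \<le> (\<Sum>g\<in>?G. exp (- (real N * V / 2 ^ card {i. near_boundary s L (g i)})))"
  proof (rule sum_mono)
    fix g assume g: "g \<in> ?G"
    define u where "u = measure lborel (ball (z g) s \<inter> unit_cube)"
    have "V / 2 ^ card {i. near_boundary s L (g i)} \<le> u"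
      using measure_ball_Int_unit_cube_ge[OF z_cube[OF g] s]
      by (simp add: V_def u_def z_def near_boundary_def)
    then have "real N * (V / 2 ^ card {i. near_boundary s L (g i)}) \<le> real N * u"
      by (intro mult_left_mono) auto
    moreover have "(1 - u) ^ N \<le> exp (- u) ^ N"
      using measure_Int_cube_le_1[of "ball (z g) s"] exp_ge_add_one_self[of "- u"]
      by (intro power_mono) (auto simp: u_def)
    moreover have "exp (- u) ^ N = exp (- (real N * u))"
      by (simp flip: exp_of_nat_mult)
    ultimately show "prob (vacant (ball (z g) s)) \<le> exp (- (real N * V / 2 ^ card {i. near_boundary s L (g i)}))"
      by (simp add: prob_vacant u_def order.trans)
  qed
  finally show ?thesis by (simp add: V_def)
qed

text \<open>A grid point with \<open>k\<close> coordinates away from the boundary lies near a \<open>k\<close>-dimensional face, and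
  there are of the order of \<open>(L + 1) ^ k\<close> of them. If \<open>B\<close> bounds each term against this count, then the
  term is at most \<open>B\<close> times a product of coordinate weights, and the sum of these products over the
  grid factors into a power of a one-dimensional sum.\<close>
lemma prob_less_rho_strata:
  assumes s: "0 < s" "s \<le> 1/2" and L: "0 < L" and r: "s + real CARD('n) / real L \<le> r"
    and B: "\<And>k. k \<le> CARD('n) \<Longrightarrow> (real L + 1) ^ k
       * exp (- (real N * (unit_ball_vol (real CARD('n)) * s ^ CARD('n)) / 2 ^ (CARD('n) - k))) \<le> B"
  shows "prob {\<omega> \<in> space M. r < rho \<omega>} \<le> B * (3 + 2 * s * real L) ^ CARD('n)"
proof -
  \<comment> \<open>each coordinate away from the boundary contributes one factor \<open>1 / (L + 1)\<close>\<close>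
  define w where "w i = (if near_boundary s L i then 1 else 1 / (real L + 1))" for i
  have w_nonneg: "0 \<le> w i" for i by (simp add: w_def)
  have "0 \<le> B"
    by (rule order.trans[OF _ B[of 0]]) auto
  let ?G = "(UNIV :: 'n set) \<rightarrow>\<^sub>E {..L}"
  have "prob {\<omega> \<in> space M. r < rho \<omega>}
    \<le> (\<Sum>g\<in>?G. exp (- (real N * (unit_ball_vol (real CARD('n)) * s ^ CARD('n))
                    / 2 ^ card {i. near_boundary s L (g i)})))"
    by (rule prob_less_rho_grid[OF s L r])
  also have "\<dots> \<le> (\<Sum>g\<in>?G. B * (\<Prod>i\<in>UNIV. w (g i)))"
  proof (rule sum_mono)
    fix g :: "'n \<Rightarrow> nat"
    define k where "k = card {i. \<not> near_boundary s L (g i)}"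
    have "k \<le> CARD('n)" by (simp add: k_def card_mono)
    have "card {i. near_boundary s L (g i)} = CARD('n) - k"
      unfolding k_def by (simp add: Collect_neg_eq Compl_eq_Diff_UNIV card_Diff_subset card_mono)
    moreover have "(\<Prod>i\<in>UNIV. w (g i)) = 1 / (real L + 1) ^ k"
      by (simp add: w_def prod.If_cases k_def power_one_over Collect_neg_eq)
    ultimately show "exp (- (real N * (unit_ball_vol (real CARD('n)) * s ^ CARD('n))
                    / 2 ^ card {i. near_boundary s L (g i)})) \<le> B * (\<Prod>i\<in>UNIV. w (g i))"
      using B[OF \<open>k \<le> CARD('n)\<close>] by (simp add: pos_le_divide_eq mult.commute)
  qed
  also have "\<dots> = B * (\<Prod>i\<in>(UNIV :: 'n set). \<Sum>j\<le>L. w j)"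
    by (subst prod_sum_PiE) (auto simp: sum_distrib_left)
  also have "\<dots> \<le> B * (3 + 2 * s * real L) ^ CARD('n)"
    using sum_near_boundary_weight[OF L s(1)] \<open>0 \<le> B\<close> w_nonneg
    by (simp add: w_def[symmetric]) (intro mult_left_mono power_mono sum_nonneg; simp)
  finally show ?thesis .
qed

text \<open>Here \<open>t\<close> is the ratio of \<open>N * ((1 - \<eta>) * r) ^ d\<close> to its critical value, where \<open>d\<close> is the dimension
  of the cube. A \<open>k\<close>-dimensional face contributes a power of \<open>N\<close> with
  exponent \<open>(2 * k - t * 2 ^ k) / (2 * d)\<close>. By
  \<open>2 * k \<le> 2 ^ k\<close> this is at most \<open>- (t - 1) / (2 * d)\<close> whatever \<open>k\<close> is. The constant in front depends
  only on the dimension and on \<open>\<eta>\<close>, the fraction of the radius given up to the mesh of the grid.\<close>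
lemma prob_less_rho_tail:
  fixes \<eta> r t :: real
  assumes \<eta>: "0 < \<eta>" "\<eta> < 1" and r: "0 < r" "r \<le> 1/2"
    and large: "1 \<le> r * real N powr (1 / real CARD('n))"
    and t: "1 \<le> t"
      "real N * (unit_ball_vol (real CARD('n)) * ((1 - \<eta>) * r) ^ CARD('n))
        = t * 2 ^ (CARD('n) - 1) / real CARD('n) * ln (real N)"
  shows "prob {\<omega> \<in> space M. r < rho \<omega>}
    \<le> ((real CARD('n) / \<eta> + 2) * (5 + 2 * real CARD('n) / \<eta>)) ^ CARD('n)
        * real N powr (- (t - 1) / (2 * real CARD('n)))"
proof -
  define d where "d = real CARD('n)"
  define s where "s = (1 - \<eta>) * r"
  \<comment> \<open>a grid of mesh \<open>1 / L\<close> comes within \<open>d / L \<le> \<eta> * r\<close> of each point of the cube\<close>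
  define L where "L = nat \<lceil>d / (\<eta> * r)\<rceil>"
  define K where "K = d / \<eta> + 2"
  have d: "0 < d" by (simp add: d_def)
  have q: "0 < d / (\<eta> * r)" using d \<eta> r by simp
  have L: "0 < L" "d / (\<eta> * r) \<le> real L" "real L \<le> d / (\<eta> * r) + 1"
    using q unfolding L_def by linarith+
  have sr: "0 < s" "s \<le> r" "s \<le> 1/2"
  proof -
    show "0 < s" using \<eta> r by (simp add: s_def)
    have "(1 - \<eta>) * r \<le> 1 * r" using \<eta> r by (intro mult_right_mono) auto
    then show "s \<le> r" "s \<le> 1/2" using r(2) unfolding s_def by linarith+
  qed
  have "d \<le> real L * (\<eta> * r)"
    using L(2) \<eta> r by (subst (asm) pos_divide_le_eq) auto
  then have "d / real L \<le> \<eta> * r"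
    using L(1) by (simp add: pos_divide_le_eq mult.commute)
  then have mesh: "s + real CARD('n) / real L \<le> r"
    by (simp add: s_def d_def algebra_simps)
  have N1: "1 \<le> real N" using N by simp
  have K: "1 \<le> K" using d \<eta> by (simp add: K_def)
  have sL: "3 + 2 * s * real L \<le> 5 + 2 * d / \<eta>"
  proof -
    have "s * real L \<le> r * (d / (\<eta> * r) + 1)"
      using sr L r by (intro mult_mono) auto
    also have "\<dots> = d / \<eta> + r"
      using r by (simp add: field_simps)
    finally show ?thesis using r by simp
  qed
  have L_le: "real L + 1 \<le> K * real N powr (1 / d)"
  proof -
    have "1 / r \<le> real N powr (1 / d)"
      using large r by (simp add: field_simps d_def)
    then have "d / \<eta> * (1 / r) \<le> d / \<eta> * real N powr (1 / d)"
      using d \<eta> by (intro mult_left_mono) auto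
    moreover have "1 \<le> real N powr (1 / d)"
      using N1 d by (intro ge_one_powr_ge_zero) auto
    ultimately show ?thesis
      using L(3) by (simp add: K_def algebra_simps)
  qed
  have "(real L + 1) ^ k * exp (- (real N * (unit_ball_vol (real CARD('n)) * s ^ CARD('n)) / 2 ^ (CARD('n) - k)))
      \<le> K ^ CARD('n) * real N powr (- (t - 1) / (2 * d))" if k: "k \<le> CARD('n)" for k
  proof -
    have "real N * (unit_ball_vol (real CARD('n)) * s ^ CARD('n)) / 2 ^ (CARD('n) - k)
        = t * 2 ^ k / (2 * d) * ln (real N)"
    proof -
      have "(2 :: real) ^ CARD('n) = 2 ^ (CARD('n) - k) * 2 ^ k"
        using k by (simp flip: power_add)
      moreover have "(2 :: real) ^ CARD('n) = 2 ^ (CARD('n) - 1) * 2"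
        by (simp flip: power_Suc2)
      ultimately have "(2 :: real) ^ (CARD('n) - 1) / 2 ^ (CARD('n) - k) = 2 ^ k / 2"
        by (simp add: field_simps)
      moreover have "real N * (unit_ball_vol (real CARD('n)) * s ^ CARD('n)) / 2 ^ (CARD('n) - k)
          = t * (2 ^ (CARD('n) - 1) / 2 ^ (CARD('n) - k)) / d * ln (real N)"
        unfolding s_def d_def t(2) by simp
      ultimately have "real N * (unit_ball_vol (real CARD('n)) * s ^ CARD('n)) / 2 ^ (CARD('n) - k)
          = t * (2 ^ k / 2) / d * ln (real N)"
        by (simp only:)
      then show ?thesis
        by simp
    qed
    then have exp_eq: "exp (- (real N * (unit_ball_vol (real CARD('n)) * s ^ CARD('n)) / 2 ^ (CARD('n) - k)))
        = real N powr (- (t * 2 ^ k / (2 * d)))"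
      using N1 by (simp add: powr_def)
    have "(real L + 1) ^ k \<le> (K * real N powr (1 / d)) ^ k"
      by (intro power_mono L_le) auto
    also have "\<dots> = K ^ k * real N powr (real k / d)"
      using N1 by (simp add: power_mult_distrib powr_power)
    also have "\<dots> \<le> K ^ CARD('n) * real N powr (real k / d)"
      using K k by (intro mult_right_mono power_increasing) auto
    finally have "(real L + 1) ^ k * exp (- (real N * (unit_ball_vol (real CARD('n)) * s ^ CARD('n)) / 2 ^ (CARD('n) - k)))
      \<le> K ^ CARD('n) * real N powr (real k / d) * real N powr (- (t * 2 ^ k / (2 * d)))"
      unfolding exp_eq by (intro mult_right_mono) auto
    also have "\<dots> = K ^ CARD('n) * real N powr (real k / d - t * 2 ^ k / (2 * d))"
      by (simp add: powr_diff powr_minus field_simps)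
    also have "\<dots> \<le> K ^ CARD('n) * real N powr (- (t - 1) / (2 * d))"
    proof (intro mult_left_mono powr_mono N1)
      have "real (2 * k) \<le> real (2 ^ k)"
        using two_mult_le_two_power[of k] by linarith
      moreover have "(t - 1) * 1 \<le> (t - 1) * 2 ^ k"
        using t(1) by (intro mult_left_mono) auto
      ultimately have "2 * real k - t * 2 ^ k \<le> - (t - 1)"
        by (simp add: algebra_simps)
      then have "(2 * real k - t * 2 ^ k) / (2 * d) \<le> - (t - 1) / (2 * d)"
        using d by (intro divide_right_mono) auto
      then show "real k / d - t * 2 ^ k / (2 * d) \<le> - (t - 1) / (2 * d)"
        by (simp add: diff_divide_distrib)
    qed (use K in auto)
    finally show ?thesis .
  qed
  then have "prob {\<omega> \<in> space M. r < rho \<omega>}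
      \<le> K ^ CARD('n) * real N powr (- (t - 1) / (2 * d)) * (3 + 2 * s * real L) ^ CARD('n)"
    by (intro prob_less_rho_strata sr L(1) mesh)
  also have "\<dots> \<le> K ^ CARD('n) * real N powr (- (t - 1) / (2 * d)) * (5 + 2 * d / \<eta>) ^ CARD('n)"
    using K sr sL by (intro mult_left_mono power_mono) auto
  finally show ?thesis
    by (simp add: K_def d_def power_mult_distrib mult_ac)
qed

end

section \<open>Moments of the covering radius\<close>

context uniform_sample
begin

lemma integrable_rho_powr:
  assumes "0 \<le> p"
  shows "integrable M (\<lambda>\<omega>. rho \<omega> powr p)"
proof (rule integrable_const_bound)
  show "AE \<omega> in M. norm (rho \<omega> powr p) \<le> real CARD('n) powr p"
    using AE_rho_le
  proof eventually_elim
    case (elim \<omega>)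
    then show ?case
      using rho_nonneg assms by (auto intro: powr_mono2)
  qed
qed simp

lemma expectation_rho_powr_ge:
  assumes "0 \<le> r" "0 \<le> p"
  shows "r powr p * (1 - prob {\<omega> \<in> space M. rho \<omega> < r}) \<le> expectation (\<lambda>\<omega>. rho \<omega> powr p)"
proof -
  have eq: "{\<omega> \<in> space M. r \<le> rho \<omega>} = space M - {\<omega> \<in> space M. rho \<omega> < r}"
    by auto
  have "r powr p * (1 - prob {\<omega> \<in> space M. rho \<omega> < r})
      = expectation (\<lambda>\<omega>. r powr p * indicator {\<omega> \<in> space M. r \<le> rho \<omega>} \<omega>)"
    unfolding eq by (simp add: prob_compl)
  also have "\<dots> \<le> expectation (\<lambda>\<omega>. rho \<omega> powr p)"
  proof (rule integral_mono)
    show "integrable M (\<lambda>\<omega>. r powr p * indicator {\<omega> \<in> space M. r \<le> rho \<omega>} \<omega>)"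
      by (intro integrable_mult_right integrable_real_indicator) (auto simp: emeasure_eq_measure)
    show "r powr p * indicator {\<omega> \<in> space M. r \<le> rho \<omega>} \<omega> \<le> rho \<omega> powr p" for \<omega>
      using assms by (auto simp: indicator_def intro: powr_mono2)
  qed (rule integrable_rho_powr[OF assms(2)])
  finally show ?thesis .
qed

text \<open>The levels \<open>r\<close> and \<open>r'\<close> have different purposes. The probability of exceeding \<open>r\<close> may tend to zero
  slowly, but the contribution from there is of size \<open>r' powr p\<close>; beyond \<open>r'\<close> only the crude bound by
  the dimension remains, so \<open>r'\<close> must be exceeded with very small probability.\<close>
lemma expectation_rho_powr_le:
  assumes "0 \<le> r" "0 \<le> r'" "0 \<le> p"
  shows "expectation (\<lambda>\<omega>. rho \<omega> powr p)
    \<le> r powr p + r' powr p * prob {\<omega> \<in> space M. r < rho \<omega>}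
        + real CARD('n) powr p * prob {\<omega> \<in> space M. r' < rho \<omega>}"
proof -
  let ?I = "\<lambda>r. indicator {\<omega> \<in> space M. r < rho \<omega>} :: 'w \<Rightarrow> real"
  have int: "integrable M (?I r)" for r
    by (intro integrable_real_indicator) (auto simp: emeasure_eq_measure)
  have "expectation (\<lambda>\<omega>. rho \<omega> powr p)
      \<le> expectation (\<lambda>\<omega>. r powr p + r' powr p * ?I r \<omega> + real CARD('n) powr p * ?I r' \<omega>)"
  proof (rule integral_mono_AE[OF integrable_rho_powr[OF assms(3)]])
    show "integrable M (\<lambda>\<omega>. r powr p + r' powr p * ?I r \<omega> + real CARD('n) powr p * ?I r' \<omega>)"
      by (intro Bochner_Integration.integrable_add integrable_mult_right int) simp
    show "AE \<omega> in M. rho \<omega> powr p \<le> r powr p + r' powr p * ?I r \<omega> + real CARD('n) powr p * ?I r' \<omega>"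
      using AE_rho_le AE_space
    proof eventually_elim
      case (elim \<omega>)
      have mono: "rho \<omega> powr p \<le> b powr p" if "rho \<omega> \<le> b" for b
        using that assms rho_nonneg by (intro powr_mono2) auto
      consider "rho \<omega> \<le> r" | "r < rho \<omega>" "rho \<omega> \<le> r'" | "r' < rho \<omega>"
        by linarith
      then show ?case
      proof cases
        case 1
        have "0 \<le> r' powr p * ?I r \<omega> + real CARD('n) powr p * ?I r' \<omega>" by simp
        then show ?thesis using mono[OF 1] by linarith
      next
        case 2
        then show ?thesis using mono[OF 2(2)] elim by (simp add: add_increasing)
      next
        case 3
        then show ?thesis using mono[OF elim(1)] elim by (simp add: add_increasing)
      qed
    qed
  qed
  also have "\<dots> = r powr p + r' powr p * prob {\<omega> \<in> space M. r < rho \<omega>}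
        + real CARD('n) powr p * prob {\<omega> \<in> space M. r' < rho \<omega>}"
    using int by (simp add: prob_space)
  finally show ?thesis .
qed

end

section \<open>Asymptotics\<close>

definition scaled_radius :: "nat \<Rightarrow> real \<Rightarrow> nat \<Rightarrow> real" where
  "scaled_radius d a N = (a * ln (real N) / real N) powr (1 / real d)"

text \<open>For \<open>r = scaled_radius d a N\<close> with \<open>a\<close> equal to this constant, the part in the cube of a ball of
  radius \<open>r\<close> about a point of an edge, away from its ends, has volume \<open>ln N / (d * N)\<close>. It is vacant with probability about
  \<open>N powr (- 1 / d)\<close>, which balances the number of disjoint balls along the edge up to logarithms.\<close>
definition edge_constant :: "nat \<Rightarrow> real" where
  "edge_constant d = 2 ^ (d - 1) / (real d * unit_ball_vol (real d))"

lemma edge_constant_pos: "0 < d \<Longrightarrow> 0 < edge_constant d"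
  by (simp add: edge_constant_def)

lemma unit_ball_vol_edge_constant:
  assumes "0 < d"
  shows "unit_ball_vol (real d) = 2 ^ (d - 1) / (real d * edge_constant d)"
proof -
  have "unit_ball_vol (real d) \<noteq> 0"
    using unit_ball_vol_pos[of "real d"] by linarith
  then show ?thesis
    using assms by (simp add: edge_constant_def)
qed

lemma scaled_radius_power:
  assumes "0 < d" "0 < a" "1 < N"
  shows "scaled_radius d a N ^ d = a * ln (real N) / real N"
proof -
  have "scaled_radius d a N ^ d = (a * ln (real N) / real N) powr (1 / real d * real d)"
    unfolding scaled_radius_def using assms by (subst powr_powr[symmetric]) (simp add: powr_realpow)
  then show ?thesis using assms by simp
qed

lemma scaled_radius_powr:
  assumes "0 < d" "0 < a" "1 < N"
  shows "scaled_radius d a N powr p * (real N / ln (real N)) powr (p / real d) = a powr (p / real d)"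
proof -
  have "scaled_radius d a N powr p = (a * (ln (real N) / real N)) powr (p / real d)"
    by (simp add: scaled_radius_def powr_powr)
  also have "\<dots> = a powr (p / real d) * (ln (real N) / real N) powr (p / real d)"
    by (rule powr_mult)
  finally have "scaled_radius d a N powr p = a powr (p / real d) * (ln (real N) / real N) powr (p / real d)" .
  moreover have "(ln (real N) / real N) powr (p / real d) * (real N / ln (real N)) powr (p / real d) = 1"
    using assms by (subst powr_mult[symmetric]) auto
  ultimately show ?thesis
    by (simp add: mult.assoc)
qed

lemma tendsto_scaled_radius:
  assumes "0 < d" "0 < a"
  shows "scaled_radius d a \<longlonglongrightarrow> 0"
proof -
  define b where "b = 1 / real d"
  have "0 < b" using assms by (simp add: b_def)
  then have "(\<lambda>N. (a * ln (real N) / real N) powr b) \<longlonglongrightarrow> 0"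
    using assms by real_asymp
  then show ?thesis by (simp add: scaled_radius_def[abs_def] b_def)
qed

lemma eventually_scaled_radius:
  assumes "0 < d" "0 < a" "0 < e"
  shows "eventually (\<lambda>N. 1 < N \<and> 0 < scaled_radius d a N \<and> scaled_radius d a N \<le> e
           \<and> 1 \<le> scaled_radius d a N * real N powr (1 / real d)) sequentially"
proof -
  have "eventually (\<lambda>N. scaled_radius d a N < e) sequentially"
    using order_tendstoD(2)[OF tendsto_scaled_radius[OF assms(1,2)] assms(3)] .
  moreover have "eventually (\<lambda>N. 1 \<le> a * ln (real N)) sequentially"
    using assms by real_asymp
  moreover have "eventually (\<lambda>N. 1 < N) sequentially"
    by (rule eventually_gt_at_top)
  ultimately show ?thesis
  proof eventually_elim
    case (elim N)
    have "scaled_radius d a N * real N powr (1 / real d) = (a * ln (real N)) powr (1 / real d)"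
      unfolding scaled_radius_def using elim assms by (subst powr_mult[symmetric]) auto
    moreover have "1 \<le> (a * ln (real N)) powr (1 / real d)"
      using elim assms by (intro ge_one_powr_ge_zero) auto
    moreover have "0 < scaled_radius d a N"
      using elim assms by (simp add: scaled_radius_def)
    ultimately show ?case using elim by simp
  qed
qed

text \<open>The denominator behaves like \<open>N powr (- e)\<close> and the numerator like \<open>N powr (- b)\<close> up to logarithms.\<close>
lemma tendsto_vacancy_ratio:
  fixes a b e :: real
  assumes "0 < a" "0 < e" "e < b"
  shows "(\<lambda>N. 4 * (a * ln (real N) / real N) powr b / (1 - e * ln (real N) / real N) ^ N) \<longlonglongrightarrow> 0"
  using assms by real_asymp

text \<open>Below the critical constant the expected number of vacant balls along an edge tends to infinity,
  so the second moment bound applies with a right-hand side that tends to zero.\<close>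
lemma tendsto_prob_rho_less:
  fixes M :: "nat \<Rightarrow> 'w measure" and x :: "nat \<Rightarrow> nat \<Rightarrow> 'w \<Rightarrow> real ^ 'n"
  assumes U: "\<And>N. N \<ge> 1 \<Longrightarrow> uniform_sample (M N) (x N) N"
    and a: "0 < a" "a < edge_constant CARD('n)"
  shows "(\<lambda>N. measure (M N) {\<omega> \<in> space (M N). uniform_sample.rho (x N) N \<omega> < scaled_radius CARD('n) a N})
           \<longlonglongrightarrow> 0"
proof -
  define d where "d = CARD('n)"
  define c where "c = edge_constant d"
  define e where "e = a / c / real d"
  have d: "0 < d" by (simp add: d_def)
  have c: "0 < c" "a < c" using a by (auto simp: c_def d_def edge_constant_pos)
  have e: "0 < e" "e < 1 / real d"
    using a c d divide_strict_right_mono[of "a / c" 1 "real d"] by (auto simp: e_def)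
  have lim: "(\<lambda>N. 4 * scaled_radius d a N / (1 - e * ln (real N) / real N) ^ N) \<longlonglongrightarrow> 0"
    using tendsto_vacancy_ratio[OF a(1) e] by (simp add: scaled_radius_def)
  have "eventually (\<lambda>N. e * ln (real N) / real N < 1) sequentially"
    using e by real_asymp
  then have "eventually (\<lambda>N. measure (M N) {\<omega> \<in> space (M N). uniform_sample.rho (x N) N \<omega> < scaled_radius d a N}
      \<le> 4 * scaled_radius d a N / (1 - e * ln (real N) / real N) ^ N) sequentially"
    using eventually_scaled_radius[OF d a(1), of "1/4", simplified]
  proof eventually_elim
    case (elim N)
    define r where "r = scaled_radius d a N"
    define m where "m = nat \<lfloor>1 / (2 * r)\<rfloor>"
    define v where "v = e * ln (real N) / real N"
    have r: "0 < r" "r \<le> 1/4" "1 < N" using elim by (auto simp: r_def)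
    interpret uniform_sample "M N" "x N" N
      using r by (intro U) simp
    have "2 \<le> 1 / (2 * r)"
      using r by (simp add: field_simps)
    then have m: "0 < m" "real m \<le> 1 / (2 * r)" "1 / (2 * r) - 1 \<le> real m"
      unfolding m_def by linarith+
    have "2 * r * real m \<le> 1"
      using m(2) r by (simp add: field_simps)
    have "1 / (4 * r) \<le> 1 / (2 * r) - 1"
      using r by (simp add: field_simps)
    then have m_ge: "1 / (4 * r) \<le> real m"
      using m by linarith
    have v_eq: "unit_ball_vol (real d) * r ^ d / 2 ^ (d - 1) = v"
      using d a r scaled_radius_power[OF d a(1), of N]
      by (simp add: r_def v_def e_def c_def unit_ball_vol_edge_constant)
    have "v < 1" using elim by (simp add: v_def)
    have "prob {\<omega> \<in> space (M N). rho \<omega> < r} \<le> 1 / (real m * (1 - v) ^ N)"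
      using r m(1) \<open>2 * r * real m \<le> 1\<close> v_eq \<open>v < 1\<close>
      by (intro prob_rho_less) (auto simp: d_def)
    also have "\<dots> \<le> 1 / (1 / (4 * r) * (1 - v) ^ N)"
      using m_ge m(1) r \<open>v < 1\<close> by (intro divide_left_mono mult_right_mono mult_pos_pos) auto
    also have "\<dots> = 4 * r / (1 - v) ^ N"
      by simp
    finally show ?case
      by (simp add: r_def v_def)
  qed
  then show ?thesis
    unfolding d_def[symmetric]
    by (intro tendsto_sandwich[OF _ _ tendsto_const lim]) auto
qed

text \<open>Exceeding the critical constant by the factor \<open>t\<^sup>2\<close> leaves room for both purposes: one factor \<open>t\<close>
  is spent on the mesh of the grid, the other one gives the decay.\<close>
lemma eventually_prob_less_rho:
  fixes M :: "nat \<Rightarrow> 'w measure" and x :: "nat \<Rightarrow> nat \<Rightarrow> 'w \<Rightarrow> real ^ 'n"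
  assumes U: "\<And>N. N \<ge> 1 \<Longrightarrow> uniform_sample (M N) (x N) N"
    and t: "1 < t"
  shows "\<exists>C. eventually (\<lambda>N. measure (M N) {\<omega> \<in> space (M N).
             scaled_radius CARD('n) (t ^ 2 * edge_constant CARD('n)) N < uniform_sample.rho (x N) N \<omega>}
           \<le> C * real N powr (- (t - 1) / (2 * real CARD('n)))) sequentially"
proof -
  define d where "d = CARD('n)"
  define a where "a = t ^ 2 * edge_constant d"
  \<comment> \<open>chosen so that \<open>(1 - \<eta>) ^ d = 1 / t\<close>\<close>
  define \<eta> where "\<eta> = 1 - (1 / t) powr (1 / real d)"
  have d: "0 < d" by (simp add: d_def)
  have c: "0 < edge_constant d" by (rule edge_constant_pos[OF d])
  have a: "0 < a" using c t by (simp add: a_def)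
  have "(1 / t) powr (1 / real d) < 1 powr (1 / real d)"
    using t d by (intro powr_less_mono2) auto
  then have \<eta>: "0 < \<eta>" "\<eta> < 1"
    using t by (auto simp: \<eta>_def)
  have "(1 - \<eta>) ^ d = (1 / t) powr (1 / real d * real d)"
    unfolding \<eta>_def using t by (subst powr_powr[symmetric]) (simp add: powr_realpow)
  then have \<eta>_power: "(1 - \<eta>) ^ d = 1 / t"
    using d t by simp
  have "eventually (\<lambda>N. measure (M N) {\<omega> \<in> space (M N). scaled_radius d a N < uniform_sample.rho (x N) N \<omega>}
      \<le> ((real d / \<eta> + 2) * (5 + 2 * real d / \<eta>)) ^ d * real N powr (- (t - 1) / (2 * real d))) sequentially"
    using eventually_scaled_radius[OF d a, of "1/2", simplified]
  proof eventually_elim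
    case (elim N)
    interpret uniform_sample "M N" "x N" N
      using elim by (intro U) simp
    have "real N * (unit_ball_vol (real d) * ((1 - \<eta>) * scaled_radius d a N) ^ d)
        = t * 2 ^ (d - 1) / real d * ln (real N)"
      using elim d a c t
      by (simp add: power_mult_distrib \<eta>_power scaled_radius_power unit_ball_vol_edge_constant)
         (simp add: a_def power2_eq_square)
    then show ?case
      using elim \<eta> t unfolding d_def by (intro prob_less_rho_tail) auto
  qed
  then show ?thesis
    unfolding a_def d_def by blast
qed

theorem proposition3p9:
  fixes M :: "nat \<Rightarrow> 'w measure"
    and x :: "nat \<Rightarrow> nat \<Rightarrow> 'w \<Rightarrow> real ^ 'n"
    and p :: real
  assumes dim: "CARD('n) \<ge> 2"
    and prob: "\<And>N. N \<ge> 1 \<Longrightarrow> prob_space (M N)"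
    and indep: "\<And>N. N \<ge> 1 \<Longrightarrow> prob_space.indep_vars (M N) (\<lambda>_. borel) (x N) {1..N}"
    and distr: "\<And>N j. N \<ge> 1 \<Longrightarrow> j \<in> {1..N} \<Longrightarrow> distr (M N) borel (x N j) = cube_measure"
    and p: "p \<ge> 1"
  shows "(\<lambda>N. (\<integral>\<omega>. covering_radius ((\<lambda>j. x N j \<omega>) ` {1..N}) unit_cube powr p \<partial>M N)
              * (real N / ln (real N)) powr (p / real CARD('n)))
          \<longlonglongrightarrow> (2 ^ (CARD('n) - 1) / (real CARD('n) * unit_ball_vol (real CARD('n))))
                powr (p / real CARD('n))"
proof -
  have U: "uniform_sample (M N) (x N) N" if "N \<ge> 1" for N
    using that prob indep distr by (intro uniform_sample.intro uniform_sample_axioms.intro) auto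
  define d where "d = CARD('n)"
  define q where "q = p / real d"
  define c where "c = edge_constant d"
  define radius where "radius N = uniform_sample.rho (x N) N" for N
  define S where "S N = (real N / ln (real N)) powr q" for N
  define F where "F N = (\<integral>\<omega>. radius N \<omega> powr p \<partial>M N) * S N" for N
  have d: "0 < d" by (simp add: d_def)
  have q: "0 < q" using p d by (simp add: q_def)
  have c: "0 < c" using edge_constant_pos[OF d] by (simp add: c_def)
  have S_nonneg: "0 \<le> S N" for N by (simp add: S_def)
  have rS: "scaled_radius d a N powr p * S N = a powr q" if "0 < a" "1 < N" for a N
    using scaled_radius_powr[OF d that] by (simp add: S_def q_def)
  have powr_cont: "((\<lambda>a. a powr q) \<longlongrightarrow> c powr q) (at c within A)" for A
    using c by (intro tendsto_intros) auto

  have lower: "eventually (\<lambda>N. L < F N) sequentially" if L: "L < c powr q" for L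
  proof -
    have "eventually (\<lambda>a. L < a powr q \<and> 0 < a \<and> a < c) (at_left c)"
      using order_tendstoD(1)[OF powr_cont L] eventually_at_left_real[OF c]
      by eventually_elim auto
    then obtain a where a: "L < a powr q" "0 < a" "a < c"
      using eventually_happens'[OF trivial_limit_at_left_real] by blast
    define P where "P N = measure (M N) {\<omega> \<in> space (M N). radius N \<omega> < scaled_radius d a N}" for N
    have "P \<longlonglongrightarrow> 0"
      using tendsto_prob_rho_less[of M x a, OF U] a by (simp add: P_def[abs_def] radius_def c_def d_def)
    then have "(\<lambda>N. a powr q * (1 - P N)) \<longlonglongrightarrow> a powr q * (1 - 0)"
      by (intro tendsto_intros)
    then have "eventually (\<lambda>N. L < a powr q * (1 - P N)) sequentially"
      using a(1) by (intro order_tendstoD(1)) auto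
    then show ?thesis
      using eventually_gt_at_top[of 1]
    proof eventually_elim
      case (elim N)
      interpret uniform_sample "M N" "x N" N
        using elim by (intro U) simp
      have "scaled_radius d a N powr p * (1 - P N) \<le> (\<integral>\<omega>. radius N \<omega> powr p \<partial>M N)"
        unfolding P_def radius_def
        using p by (intro expectation_rho_powr_ge) (auto simp: scaled_radius_def)
      then have "scaled_radius d a N powr p * (1 - P N) * S N \<le> F N"
        unfolding F_def using S_nonneg by (intro mult_right_mono)
      moreover have "scaled_radius d a N powr p * (1 - P N) * S N = a powr q * (1 - P N)"
        by (simp only: rS[OF a(2) elim(2), symmetric] mult_ac)
      ultimately show ?case
        using elim by linarith
    qed
  qed

  have upper: "eventually (\<lambda>N. F N < R) sequentially" if R: "c powr q < R" for R
  proof -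
    have "eventually (\<lambda>t. (t ^ 2 * c) powr q < R \<and> 1 < t) (at_right 1)"
    proof -
      have "((\<lambda>t. (t ^ 2 * c) powr q) \<longlongrightarrow> (1 ^ 2 * c) powr q) (at_right 1)"
        using c by (intro tendsto_intros) auto
      then have "eventually (\<lambda>t. (t ^ 2 * c) powr q < R) (at_right 1)"
        using R by (intro order_tendstoD(2)) auto
      then show ?thesis
        using eventually_at_right_less[of 1] by eventually_elim auto
    qed
    then obtain t where t: "(t ^ 2 * c) powr q < R" "1 < t"
      using eventually_happens'[OF trivial_limit_at_right_real] by blast
    \<comment> \<open>large enough for the decay \<open>N powr (- (t' - 1) / (2 * d))\<close> to beat the scaling factor \<open>S N\<close>\<close>
    define t' where "t' = 2 + 2 * p"
    have t': "1 < t'" using p by (simp add: t'_def)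
    define a where "a = t ^ 2 * c"
    define a' where "a' = t' ^ 2 * c"
    have a: "0 < a" "0 < a'" using c t t' by (auto simp: a_def a'_def)
    define P where "P b N = measure (M N) {\<omega> \<in> space (M N). scaled_radius d b N < radius N \<omega>}" for b N
    obtain C where C: "eventually (\<lambda>N. P a N \<le> C * real N powr (- (t - 1) / (2 * real d))) sequentially"
      using eventually_prob_less_rho[of M x t, OF U t(2)] unfolding P_def a_def c_def d_def radius_def by blast
    obtain C' where C': "eventually (\<lambda>N. P a' N \<le> C' * real N powr (- (t' - 1) / (2 * real d))) sequentially"
      using eventually_prob_less_rho[of M x t', OF U t'] unfolding P_def a'_def c_def d_def radius_def by blast
    define G where "G N = a powr q + a' powr q * (C * real N powr (- (t - 1) / (2 * real d)))
        + real d powr p * (C' * real N powr (- (t' - 1) / (2 * real d))) * S N" for N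
    have "G \<longlonglongrightarrow> a powr q + a' powr q * (C * 0) + real d powr p * (C' * 0)"
    proof -
      define b where "b = - (t - 1) / (2 * real d)"
      define b' where "b' = - (t' - 1) / (2 * real d)"
      have b: "b < 0" "b' < - q"
        using t d by (auto simp: b_def b'_def t'_def q_def field_simps)
      have "(\<lambda>N. real N powr b) \<longlonglongrightarrow> 0"
        using b by real_asymp
      moreover have "(\<lambda>N. real N powr b' * (real N / ln (real N)) powr q) \<longlonglongrightarrow> 0"
        using b q by real_asymp
      ultimately have "(\<lambda>N. a powr q + a' powr q * (C * real N powr b)
          + real d powr p * (C' * (real N powr b' * (real N / ln (real N)) powr q)))
        \<longlonglongrightarrow> a powr q + a' powr q * (C * 0) + real d powr p * (C' * 0)"
        by (intro tendsto_intros)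
      then show ?thesis
        by (simp only: G_def[abs_def] S_def b_def b'_def mult.assoc)
    qed
    then have "eventually (\<lambda>N. G N < R) sequentially"
      using t(1) by (intro order_tendstoD(2)) (auto simp: a_def)
    then show ?thesis
      using C C' eventually_gt_at_top[of 1]
    proof eventually_elim
      case (elim N)
      interpret uniform_sample "M N" "x N" N
        using elim by (intro U) simp
      have "(\<integral>\<omega>. radius N \<omega> powr p \<partial>M N)
          \<le> scaled_radius d a N powr p + scaled_radius d a' N powr p * P a N + real d powr p * P a' N"
        unfolding P_def radius_def d_def
        using p by (intro expectation_rho_powr_le) (auto simp: scaled_radius_def)
      then have "F N \<le> (scaled_radius d a N powr p + scaled_radius d a' N powr p * P a N + real d powr p * P a' N) * S N"
        unfolding F_def using S_nonneg by (intro mult_right_mono)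
      also have "\<dots> = a powr q + a' powr q * P a N + real d powr p * P a' N * S N"
        by (simp only: rS[OF a(1) elim(4), symmetric] rS[OF a(2) elim(4), symmetric] distrib_left distrib_right mult_ac)
      also have "\<dots> \<le> G N"
        unfolding G_def using elim S_nonneg by (intro add_mono mult_left_mono mult_right_mono) auto
      finally show ?case using elim by simp
    qed
  qed

  have "F \<longlonglongrightarrow> c powr q"
    using lower upper by (rule order_tendstoI)
  moreover have "eventually (\<lambda>N. F N = (\<integral>\<omega>. covering_radius ((\<lambda>j. x N j \<omega>) ` {1..N}) unit_cube powr p \<partial>M N)
              * (real N / ln (real N)) powr (p / real CARD('n))) sequentially"
    using eventually_ge_at_top[of 1]
  proof eventually_elim
    case (elim N)
    then show ?case
      by (simp add: F_def radius_def uniform_sample.rho_def[OF U] S_def q_def d_def)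
  qed
  ultimately show ?thesis
    by (simp add: c_def edge_constant_def q_def d_def Lim_transform_eventually)
qed

end
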